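(* Fix an integer $d \geq 2$ and let $\lambda^* = \frac{d^d}{(d+1)^{d+1}}$. If $\lambda = -\lambda^* \exp(r - \iota\theta)$, where $\theta \in \left(0, \cos^{-1}\frac{1}{d+0.5}\right]$ and $$0 \leq r \leq \min\left\{ d \log\left(1 + \frac{1}{d}\right),\ \frac{2d(d+1)\sin^2(\theta/2)}{d^2 + 4(d+1)\sin^2(\theta/2)} \right\},$$ then $Z_G(\lambda) \neq 0$ for every graph $G$ of maximum degree at most $d+1$.
   Context: For a finite graph $G$, $Z_G(\lambda) = \sum_{I} \lambda^{|I|}$, the sum over all independent sets $I$ of $G$ (including the empty set); $\iota$ denotes the imaginary unit. *)

theory Defs
  imports Complex_Main
begin

text \<open>A finite simple graph is given by a vertex set and a set of edges, each edge being an
  unordered pair of distinct vertices.\<close>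

locale finite_simple_graph =
  fixes V :: "'a set" and E :: "'a set set"
  assumes finite_V: "finite V"
    and edges: "e \<in> E \<Longrightarrow> e \<subseteq> V \<and> card e = 2"

definition degree :: "'a set set \<Rightarrow> 'a \<Rightarrow> nat" where
  "degree E v = card {e \<in> E. v \<in> e}"

text \<open>Inserting 0 only matters for the graph without vertices, whose maximum degree is
  thereby 0.\<close>

definition max_degree :: "'a set \<Rightarrow> 'a set set \<Rightarrow> nat" where
  "max_degree V E = Max (insert 0 (degree E ` V))"

definition independent_sets :: "'a set \<Rightarrow> 'a set set \<Rightarrow> 'a set set" where
  "independent_sets V E = {I. I \<subseteq> V \<and> (\<forall>u\<in>I. \<forall>v\<in>I. {u, v} \<notin> E)}"

definition independence_poly :: "'a set \<Rightarrow> 'a set set \<Rightarrow> complex \<Rightarrow> complex" where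
  "independence_poly V E z = (\<Sum>I\<in>independent_sets V E. z ^ card I)"

definition lambda_star :: "nat \<Rightarrow> real" where
  "lambda_star d = real d ^ d / real (d + 1) ^ (d + 1)"

end

theory Submission
  imports Defs "HOL-Analysis.Complex_Transcendental"
begin

text \<open>
  For a vertex \<open>v\<close> of an induced subgraph \<open>S\<close> in which \<open>v\<close> has at most \<open>d\<close> neighbours, the ratio
  \<open>Z(S) / Z(S - v)\<close> is shown by induction on \<open>S\<close> to be \<open>exp (- w)\<close> with \<open>w\<close> in the rectangle
  \<open>Re w \<le> \<tau>\<close>, \<open>- 1 / d \<le> Im w \<le> 0\<close>, where \<open>\<tau> = ln (1 + 1 / d) - r / d\<close>. The ratio is \<open>1 - x\<close> with
  \<open>x = - z * exp s\<close>, where \<open>s\<close> is a sum of at most \<open>d\<close> points of the rectangle. The bound on \<open>Re w\<close>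
  gives \<open>norm x \<le> 1 / (d + 1)\<close>, and the bounds on \<open>Im w\<close> place the argument of \<open>x\<close> in \<open>[- pi, - \<theta>]\<close>;
  since \<open>x\<close> thus stays away from the positive axis, \<open>1 - x\<close> is so large that the bound
  \<open>Re w \<le> \<tau>\<close> reproduces itself exactly under the assumed bound on \<open>r\<close>. At a vertex with \<open>d + 1\<close>
  neighbours the argument of \<open>x\<close> still lies strictly between \<open>- 2 * pi\<close> and \<open>0\<close>, whence \<open>x \<noteq> 1\<close>.
\<close>

section \<open>Estimates for the logarithm and the norm of \<open>1 - x\<close>\<close>

lemma arctan_le_self:
  fixes x :: real
  assumes "0 \<le> x"
  shows "arctan x \<le> x"
proof -
  have "(\<lambda>t. t - arctan t) 0 \<le> (\<lambda>t. t - arctan t) x"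
  proof (rule DERIV_nonneg_imp_nondecreasing[OF assms])
    fix t :: real
    have "((\<lambda>t. t - arctan t) has_real_derivative 1 - inverse (1 + t\<^sup>2)) (at t)"
      by (auto intro!: derivative_eq_intros)
    moreover have "0 \<le> 1 - inverse (1 + t\<^sup>2)"
      by (simp add: inverse_le_1_iff)
    ultimately show "\<exists>y. ((\<lambda>t. t - arctan t) has_real_derivative y) (at t) \<and> 0 \<le> y"
      by blast
  qed
  then show ?thesis by simp
qed

text \<open>The witness is \<open>- Ln y\<close>. In the right half-plane the argument is the
  arctangent of the slope, so a bound on the slope bounds the angle.\<close>

lemma exp_rectangle:
  fixes y :: complex and c \<tau> :: real
  assumes "0 < Re y" "0 \<le> Im y" "Im y \<le> c * Re y" "exp (- \<tau>) \<le> norm y"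
  shows "\<exists>w. y = exp (- w) \<and> Re w \<le> \<tau> \<and> - c \<le> Im w \<and> Im w \<le> 0"
proof (intro exI conjI)
  have y0: "y \<noteq> 0" using assms(1) by auto
  then show "y = exp (- (- Ln y))" by simp
  have "- \<tau> \<le> ln (norm y)"
    using assms(4) y0 by (simp add: ln_ge_iff)
  then show "Re (- Ln y) \<le> \<tau>" using y0 by simp
  have im: "Im (Ln y) = arctan (Im y / Re y)"
    using Im_Ln_eq[OF y0] assms(1) by simp
  have "arctan (Im y / Re y) \<le> Im y / Re y"
    using assms by (intro arctan_le_self) simp
  also have "\<dots> \<le> c" using assms by (simp add: divide_le_eq)
  finally show "- c \<le> Im (- Ln y)" using im by simp
  show "Im (- Ln y) \<le> 0" using im assms by simp
qed

text \<open>The squared norm \<open>1 - 2 * m * cos \<phi> + m\<^sup>2\<close> is least when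
  \<open>cos \<phi>\<close> is largest, and at angle \<open>\<theta>\<close> it decreases in
  \<open>m\<close> up to \<open>cos \<theta>\<close>. The worst case is thus \<open>m = t\<close>,
  \<open>\<phi> = \<theta>\<close>, and the bound is its value there, rewritten by the half-angle
  formula.\<close>

lemma norm_diff_one_cis_ge:
  fixes m t \<theta> \<phi> :: real
  assumes "0 \<le> m" "m \<le> t" "t \<le> cos \<theta>" "cos \<phi> \<le> cos \<theta>"
  shows "(1 - t)\<^sup>2 + 4 * t * (sin (\<theta> / 2))\<^sup>2 \<le> (norm (1 - of_real m * cis (- \<phi>)))\<^sup>2"
proof -
  have "(norm (1 - of_real m * cis (- \<phi>)))\<^sup>2 = (1 - m * cos \<phi>)\<^sup>2 + (m * sin \<phi>)\<^sup>2"
    by (simp add: cmod_power2)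
  also have "\<dots> = 1 - 2 * m * cos \<phi> + m\<^sup>2 * ((cos \<phi>)\<^sup>2 + (sin \<phi>)\<^sup>2)"
    by algebra
  also have "\<dots> = 1 - 2 * m * cos \<phi> + m\<^sup>2" by simp
  also have "\<dots> \<ge> 1 - 2 * m * cos \<theta> + m\<^sup>2"
    using mult_left_mono[OF assms(4), of "2 * m"] assms(1) by simp
  finally have 1: "1 - 2 * m * cos \<theta> + m\<^sup>2 \<le> (norm (1 - of_real m * cis (- \<phi>)))\<^sup>2" .
  \<comment> \<open>The product is the quadratic at \<open>m\<close> minus the quadratic at
    \<open>t\<close>.\<close>
  have "0 \<le> (t - m) * (2 * cos \<theta> - t - m)" using assms by simp
  then have "1 - 2 * t * cos \<theta> + t\<^sup>2 \<le> 1 - 2 * m * cos \<theta> + m\<^sup>2"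
    by (simp add: algebra_simps power2_eq_square)
  moreover have c: "cos \<theta> = 1 - 2 * (sin (\<theta> / 2))\<^sup>2"
    using cos_double_sin[of "\<theta> / 2"] by simp
  have "1 - 2 * t * cos \<theta> + t\<^sup>2 = (1 - t)\<^sup>2 + 4 * t * (sin (\<theta> / 2))\<^sup>2"
    unfolding c by (simp add: algebra_simps power2_eq_square)
  ultimately show ?thesis using 1 by simp
qed

text \<open>Rests on \<open>Q / (1 + Q) \<le> ln (1 + Q)\<close>; this inequality accounts for the
  rational form of the bound on \<open>r\<close>.\<close>

lemma exp_squared_le:
  fixes D r Q :: real
  assumes "0 < D" "0 \<le> Q" "r \<le> D * Q / (2 * (1 + Q))"
  shows "(exp (r / D))\<^sup>2 \<le> 1 + Q"
proof -
  have "2 * (r / D) \<le> Q / (1 + Q)"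
    using assms by (simp add: field_simps)
  also have "\<dots> = 1 - 1 / (1 + Q)"
    using assms(2) by (simp add: field_simps)
  also have "\<dots> \<le> ln (1 + Q)"
    using ln_le_minus_one[of "1 / (1 + Q)"] assms(2) by (simp add: ln_div)
  finally have "exp (2 * (r / D)) \<le> 1 + Q" using assms(2) by (simp add: ln_ge_iff)
  then show ?thesis by (simp only: exp_double)
qed

text \<open>Closes the induction: a factor \<open>1 - x\<close> with small modulus and argument of
  \<open>x\<close> away from 0 has its negated logarithm in the rectangle again.\<close>

lemma rectangle_step:
  fixes D r m \<theta> \<phi> :: real
  assumes "1 < D" "0 \<le> m" "m \<le> 1 / (D + 1)" "0 \<le> \<theta>" "\<theta> \<le> \<phi>" "\<phi> \<le> pi"
    and cos: "1 / (D + 1) \<le> cos \<theta>"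
    and r: "r \<le> 2 * D * (D + 1) * (sin (\<theta> / 2))\<^sup>2 / (D\<^sup>2 + 4 * (D + 1) * (sin (\<theta> / 2))\<^sup>2)"
  shows "\<exists>w. 1 - of_real m * cis (- \<phi>) = exp (- w) \<and> Re w \<le> ln (1 + 1 / D) - r / D
            \<and> - (1 / D) \<le> Im w \<and> Im w \<le> 0"
proof (rule exp_rectangle)
  let ?y = "1 - of_real m * cis (- \<phi>)"
  define t where "t = 1 / (D + 1)"
  \<comment> \<open>\<open>Q\<close> is the relative gain in the squared norm over
    \<open>(1 - t)\<^sup>2\<close>, the value at angle 0.\<close>
  define Q where "Q = 4 * (D + 1) / D\<^sup>2 * (sin (\<theta> / 2))\<^sup>2"
  have Q0: "0 \<le> Q" using assms(1) by (simp add: Q_def)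
  have t1: "1 - t = D / (D + 1)" "0 < t"
    using assms(1) by (auto simp: t_def field_simps)
  have mt: "m \<le> t" using assms(3) by (simp add: t_def)
  have "m * cos \<phi> \<le> m" using mult_left_mono[OF cos_le_one assms(2), of \<phi>] by simp
  then have re: "1 - t \<le> Re ?y" using mt by simp
  then show "0 < Re ?y" using t1 assms(1) by (smt (verit) divide_pos_pos)
  show "0 \<le> Im ?y" using assms by (simp add: sin_ge_zero)
  have "m * sin \<phi> \<le> m" using mult_left_mono[OF sin_le_one assms(2), of \<phi>] by simp
  then have "Im ?y \<le> t" using mt by simp
  \<comment> \<open>The largest imaginary part over the least real part is
    \<open>t / (1 - t)\<close>, whence the height \<open>1 / D\<close> of the rectangle.\<close>
  also have "t = 1 / D * (1 - t)" using t1 assms(1) by (simp add: t_def)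
  also have "\<dots> \<le> 1 / D * Re ?y" using re assms(1) by (intro mult_left_mono) auto
  finally show "Im ?y \<le> 1 / D * Re ?y" .
  have "cos \<phi> \<le> cos \<theta>" using assms by (intro cos_monotone_0_pi_le) auto
  then have ny: "(1 - t)\<^sup>2 + 4 * t * (sin (\<theta> / 2))\<^sup>2 \<le> (norm ?y)\<^sup>2"
    using assms mt by (intro norm_diff_one_cis_ge) (auto simp: t_def)
  have "(1 - t)\<^sup>2 * Q = 4 * t * (sin (\<theta> / 2))\<^sup>2"
    using assms(1) unfolding t1(1) by (simp add: t_def Q_def power2_eq_square divide_simps)
  with ny have ny': "(1 - t)\<^sup>2 * (1 + Q) \<le> (norm ?y)\<^sup>2" by (simp add: distrib_left)
  \<comment> \<open>In terms of \<open>Q\<close>, the bound on \<open>r\<close> takes the shape that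
    \<open>exp_squared_le\<close> expects.\<close>
  have "2 * D * (D + 1) * (sin (\<theta> / 2))\<^sup>2 / (D\<^sup>2 + 4 * (D + 1) * (sin (\<theta> / 2))\<^sup>2)
      = D * Q / (2 * (1 + Q))"
  proof -
    define c where "c = (sin (\<theta> / 2))\<^sup>2"
    have e: "D\<^sup>2 * Q = 4 * (D + 1) * c" using assms(1) by (simp add: Q_def c_def)
    have n: "2 * D * (D + 1) * c = D\<^sup>2 * (D * Q) / 2"
      using e by algebra
    have den: "D\<^sup>2 + 4 * (D + 1) * c = D\<^sup>2 * (1 + Q)"
      using e by algebra
    have "2 * D * (D + 1) * c / (D\<^sup>2 + 4 * (D + 1) * c) = D\<^sup>2 * (D * Q) / 2 / (D\<^sup>2 * (1 + Q))"
      unfolding n den ..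
    also have "\<dots> = D * Q / (2 * (1 + Q))" using assms(1) by simp
    finally show ?thesis by (simp add: c_def)
  qed
  then have "(exp (r / D))\<^sup>2 \<le> 1 + Q"
    using r assms(1) Q0 by (intro exp_squared_le) auto
  then have "(1 - t)\<^sup>2 * (exp (r / D))\<^sup>2 \<le> (norm ?y)\<^sup>2"
    using ny' mult_left_mono[of "(exp (r / D))\<^sup>2" "1 + Q" "(1 - t)\<^sup>2"] by simp
  then have "(1 - t) * exp (r / D) \<le> norm ?y"
    unfolding power_mult_distrib[symmetric] by (rule power2_le_imp_le) simp
  moreover have "exp (- (ln (1 + 1 / D) - r / D)) = (1 - t) * exp (r / D)"
  proof -
    have "exp (- ln (1 + 1 / D)) = 1 / (1 + 1 / D)"
      using assms(1) by (simp add: exp_minus add_pos_pos inverse_eq_divide)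
    also have "\<dots> = 1 - t" using assms(1) t1 by (simp add: field_simps)
    finally show ?thesis
      using exp_add[of "- ln (1 + 1 / D)" "r / D"] by simp
  qed
  ultimately show "exp (- (ln (1 + 1 / D) - r / D)) \<le> norm ?y" by simp
qed

section \<open>Vertex deletion in induced subgraphs\<close>

lemma finite_independent_sets:
  "finite S \<Longrightarrow> finite (independent_sets S E)"
  by (rule finite_subset[of _ "Pow S"]) (auto simp: independent_sets_def)

lemma independence_poly_empty: "independence_poly {} E z = 1"
proof -
  have "independent_sets {} E = {{}}" by (auto simp: independent_sets_def)
  then show ?thesis by (simp add: independence_poly_def)
qed

context finite_simple_graph
begin

text \<open>Induced subgraphs are given by their vertex set alone, with \<open>E\<close> kept whole:
  edges leaving \<open>S\<close> do not affect \<open>independent_sets S E\<close>.\<close>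

definition nbrs :: "'a set \<Rightarrow> 'a \<Rightarrow> 'a set" where
  "nbrs S v = {u \<in> S. {u, v} \<in> E}"

text \<open>Settles the case \<open>u = v\<close> in the definition of independence.\<close>

lemma singleton_not_edge: "{v} \<notin> E"
  using edges by fastforce

lemma independence_poly_remove_vertex:
  assumes "S \<subseteq> V" "v \<in> S"
  shows "independence_poly S E z =
    independence_poly (S - {v}) E z + z * independence_poly (S - {v} - nbrs S v) E z"
proof -
  let ?A = "independent_sets (S - {v}) E" and ?B = "independent_sets (S - {v} - nbrs S v) E"
  have fin: "finite S" using assms(1) finite_V finite_subset by blast
  have split: "independent_sets S E = ?A \<union> insert v ` ?B"
  proof (intro equalityI subsetI)
    fix I assume I: "I \<in> independent_sets S E"
    show "I \<in> ?A \<union> insert v ` ?B"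
    proof (cases "v \<in> I")
      case True
      then have "I - {v} \<in> ?B" "I = insert v (I - {v})"
        using I by (auto simp: independent_sets_def nbrs_def)
      then show ?thesis by blast
    next
      case False
      then show ?thesis using I by (auto simp: independent_sets_def)
    qed
  next
    fix I assume "I \<in> ?A \<union> insert v ` ?B"
    then show "I \<in> independent_sets S E"
      using assms(2) singleton_not_edge
      by (auto simp: independent_sets_def nbrs_def insert_commute)
  qed
  have inj: "inj_on (insert v) ?B"
    by (rule inj_onI) (auto simp: independent_sets_def set_eq_iff subset_iff)
  have "independence_poly S E z = (\<Sum>I\<in>?A. z ^ card I) + (\<Sum>I\<in>insert v ` ?B. z ^ card I)"
    unfolding independence_poly_def split using fin
    by (intro sum.union_disjoint) (auto simp: finite_independent_sets, auto simp: independent_sets_def)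
  also have "(\<Sum>I\<in>insert v ` ?B. z ^ card I) = (\<Sum>I\<in>?B. z ^ card (insert v I))"
    using inj by (simp add: sum.reindex)
  also have "\<dots> = (\<Sum>I\<in>?B. z * z ^ card I)"
  proof (rule sum.cong[OF refl])
    fix I assume "I \<in> ?B"
    then have "v \<notin> I" "finite I"
      using fin by (auto simp: independent_sets_def intro: finite_subset)
    then show "z ^ card (insert v I) = z * z ^ card I" by simp
  qed
  finally show ?thesis by (simp add: independence_poly_def sum_distrib_left)
qed

lemma card_nbrs_le_max_degree:
  assumes "S \<subseteq> V" "v \<in> V"
  shows "card (nbrs S v) \<le> max_degree V E"
proof -
  have "finite E"
    using edges finite_V by (intro finite_subset[of E "Pow V"]) auto
  then have "card (nbrs S v) \<le> degree E v"
    unfolding degree_def nbrs_def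
    by (intro card_inj_on_le[of "\<lambda>u. {u, v}"]) (auto simp: inj_on_def doubleton_eq_iff)
  also have "\<dots> \<le> max_degree V E"
    unfolding max_degree_def using assms finite_V by (intro Max_ge) auto
  finally show ?thesis .
qed

text \<open>Once \<open>v\<close> is deleted, its neighbours have at most \<open>d\<close>
  neighbours left, so the ratio bound applies to them.\<close>

lemma card_nbrs_remove_vertex:
  assumes "S \<subseteq> V" "v \<in> S" "u \<in> nbrs S v"
  shows "card (nbrs (S - {v}) u) < card (nbrs S u)"
proof (rule psubset_card_mono)
  show "finite (nbrs S u)"
    using assms(1) finite_V by (auto simp: nbrs_def intro: finite_subset)
  show "nbrs (S - {v}) u \<subset> nbrs S u"
    using assms by (auto simp: nbrs_def insert_commute)
qed

text \<open>Deleting \<open>N\<close> one vertex at a time telescopes the ratios, so the exponents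
  add up. The product form avoids dividing by a value that might vanish.\<close>

lemma independence_poly_remove_set:
  fixes \<tau> c :: real
  assumes step: "\<And>S u. S \<subseteq> T \<Longrightarrow> u \<in> S \<Longrightarrow> card (nbrs S u) \<le> d \<Longrightarrow>
      \<exists>w. independence_poly S E z = independence_poly (S - {u}) E z * exp (- w)
          \<and> Re w \<le> \<tau> \<and> - c \<le> Im w \<and> Im w \<le> 0"
    and "T \<subseteq> V" "N \<subseteq> T" "\<And>u. u \<in> N \<Longrightarrow> card (nbrs T u) \<le> d"
  shows "\<exists>s. independence_poly T E z = independence_poly (T - N) E z * exp (- s)
          \<and> Re s \<le> real (card N) * \<tau> \<and> - real (card N) * c \<le> Im s \<and> Im s \<le> 0"
proof -
  have finT: "finite T" using assms(2) finite_V finite_subset by blast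
  then have "finite N" using assms(3) finite_subset by blast
  then show ?thesis using assms(3,4)
  proof (induction N)
    case empty
    show ?case by (intro exI[of _ 0]) simp
  next
    case (insert u N)
    then obtain s where s: "independence_poly T E z = independence_poly (T - N) E z * exp (- s)"
      "Re s \<le> real (card N) * \<tau>" "- real (card N) * c \<le> Im s" "Im s \<le> 0"
      by auto
    \<comment> \<open>Earlier deletions only lower the number of neighbours, so \<open>step\<close>
      remains applicable.\<close>
    have "card (nbrs (T - N) u) \<le> card (nbrs T u)"
      using finT by (intro card_mono) (auto simp: nbrs_def)
    then have "card (nbrs (T - N) u) \<le> d" using insert.prems(2)[of u] by simp
    with step[of "T - N" u] insert obtain w where w:
      "independence_poly (T - N) E z = independence_poly (T - N - {u}) E z * exp (- w)"
      "Re w \<le> \<tau>" "- c \<le> Im w" "Im w \<le> 0" by auto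
    have "T - N - {u} = T - insert u N" by auto
    then have "independence_poly T E z = independence_poly (T - insert u N) E z * exp (- (s + w))"
      using s(1) w(1) by (simp add: exp_diff exp_minus field_simps)
    moreover have "Re (s + w) \<le> real (card (insert u N)) * \<tau>"
      "- real (card (insert u N)) * c \<le> Im (s + w)" "Im (s + w) \<le> 0"
      using s w insert.hyps by (simp_all add: algebra_simps)
    ultimately show ?case by blast
  qed
qed

text \<open>Dividing the deletion recurrence by the polynomial of \<open>T - {v}\<close> leaves
  \<open>1 + z * exp s\<close>, where \<open>exp s\<close> collects the inverse ratios of the
  neighbours of \<open>v\<close>.\<close>

lemma independence_poly_vertex_ratio:
  fixes \<tau> c :: real
  assumes step: "\<And>S u. S \<subseteq> T - {v} \<Longrightarrow> u \<in> S \<Longrightarrow> card (nbrs S u) \<le> d \<Longrightarrow>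
      \<exists>w. independence_poly S E z = independence_poly (S - {u}) E z * exp (- w)
          \<and> Re w \<le> \<tau> \<and> - c \<le> Im w \<and> Im w \<le> 0"
    and "T \<subseteq> V" "v \<in> T" "max_degree V E \<le> d + 1"
  shows "\<exists>s. independence_poly T E z = independence_poly (T - {v}) E z * (1 + z * exp s)
          \<and> Re s \<le> real (card (nbrs T v)) * \<tau> \<and> - real (card (nbrs T v)) * c \<le> Im s \<and> Im s \<le> 0"
proof -
  have N: "nbrs T v \<subseteq> T - {v}" using singleton_not_edge by (auto simp: nbrs_def)
  have deg: "card (nbrs (T - {v}) u) \<le> d" if "u \<in> nbrs T v" for u
    using card_nbrs_remove_vertex[OF assms(2,3) that] card_nbrs_le_max_degree[OF assms(2), of u]
      assms(2,4) N that by force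
  obtain s where s: "independence_poly (T - {v}) E z
      = independence_poly (T - {v} - nbrs T v) E z * exp (- s)"
    "Re s \<le> real (card (nbrs T v)) * \<tau>" "- real (card (nbrs T v)) * c \<le> Im s" "Im s \<le> 0"
    using independence_poly_remove_set[OF step _ N deg] assms(2) by blast
  have "independence_poly (T - {v} - nbrs T v) E z = independence_poly (T - {v}) E z * exp s"
    using s(1) by (simp add: exp_minus field_simps)
  then have "independence_poly T E z = independence_poly (T - {v}) E z * (1 + z * exp s)"
    using independence_poly_remove_vertex[OF assms(2,3), of z] by (simp add: algebra_simps)
  with s show ?thesis by blast
qed

end

section \<open>The critical value and nonvanishing\<close>

lemma lambda_star_mult_exp:
  assumes "0 < d"
  shows "lambda_star d * exp (real d * ln (1 + 1 / real d)) = 1 / (real d + 1)"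
proof -
  have "exp (real d * ln (1 + 1 / real d)) = (1 + 1 / real d) ^ d"
    using assms by (simp add: exp_of_nat_mult add_pos_pos)
  also have "\<dots> = ((real d + 1) / real d) ^ d" using assms by (simp add: field_simps)
  finally have e: "exp (real d * ln (1 + 1 / real d)) = ((real d + 1) / real d) ^ d" .
  show ?thesis
    unfolding e using assms by (simp add: lambda_star_def power_divide add.commute)
qed

theorem theorem6p1:
  fixes d :: nat and r \<theta> :: real and z :: complex
    and V :: "'a set" and E :: "'a set set"
  assumes "d \<ge> 2"
    and "z = - complex_of_real (lambda_star d)
               * exp (complex_of_real r - \<i> * complex_of_real \<theta>)"
    and "0 < \<theta>" and "\<theta> \<le> arccos (1 / (real d + 1 / 2))"
    and "0 \<le> r"
    and "r \<le> min (real d * ln (1 + 1 / real d))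
                 (2 * real d * (real d + 1) * (sin (\<theta> / 2))\<^sup>2
                    / ((real d)\<^sup>2 + 4 * (real d + 1) * (sin (\<theta> / 2))\<^sup>2))"
    and "finite_simple_graph V E"
    and "max_degree V E \<le> d + 1"
  shows "independence_poly V E z \<noteq> 0"
proof -
  interpret finite_simple_graph V E by fact
  define D where "D = real d"
  define \<tau> where "\<tau> = ln (1 + 1 / D) - r / D"
  have D: "2 \<le> D" using assms(1) by (simp add: D_def)
  have "r \<le> D * ln (1 + 1 / D)" using assms(6) by (simp add: D_def)
  \<comment> \<open>The sign of \<open>\<tau>\<close> allows a neighbour count of at most
    \<open>d\<close> to be replaced by \<open>d\<close> in the bound on \<open>Re s\<close>.\<close>
  then have \<tau>0: "0 \<le> \<tau>" using D by (simp add: \<tau>_def field_simps)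
  have b: "0 \<le> 1 / (D + 1 / 2)" "1 / (D + 1 / 2) \<le> 1" using D by auto
  then have b': "- 1 \<le> 1 / (D + 1 / 2)" by linarith
  have \<theta>_half: "\<theta> \<le> pi / 2"
    using assms(4) arccos_le_pi2[OF b] by (simp add: D_def)
  have "1 / (D + 1) \<le> 1 / (D + 1 / 2)" using D by (simp add: field_simps)
  also have "\<dots> = cos (arccos (1 / (D + 1 / 2)))" using b' b(2) by (intro cos_arccos[symmetric])
  also have "\<dots> \<le> cos \<theta>"
    using assms(3,4) arccos_ubound[OF b' b(2)] by (intro cos_monotone_0_pi_le) (auto simp: D_def)
  finally have cos\<theta>: "1 / (D + 1) \<le> cos \<theta>" .

  \<comment> \<open>The modulus bound is conditional, since with \<open>d + 1\<close> neighbours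
    \<open>Re s\<close> may exceed \<open>D * \<tau>\<close>. The minus sign in
    \<open>cis (- \<phi>)\<close> makes \<open>Im s \<le> 0\<close> push \<open>\<phi>\<close> above
    \<open>\<theta>\<close>.\<close>
  have polar: "\<exists>m \<phi>. 1 + z * exp s = 1 - of_real m * cis (- \<phi>) \<and> 0 < m
      \<and> (Re s \<le> D * \<tau> \<longrightarrow> m \<le> 1 / (D + 1)) \<and> \<phi> = \<theta> - Im s" for s
  proof (intro exI conjI impI)
    let ?m = "lambda_star d * exp (r + Re s)"
    have "exp (complex_of_real r - \<i> * complex_of_real \<theta>) * exp s
        = of_real (exp (r + Re s)) * cis (- (\<theta> - Im s))"
      unfolding exp_add[symmetric]
      by (subst exp_eq_polar) simp
    then show "1 + z * exp s = 1 - of_real ?m * cis (- (\<theta> - Im s))"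
      by (simp add: assms(2) mult.assoc)
    have l0: "0 < lambda_star d" using D by (simp add: lambda_star_def D_def)
    then show "0 < ?m" by simp
    assume "Re s \<le> D * \<tau>"
    then have "r + Re s \<le> D * ln (1 + 1 / D)" using D by (simp add: \<tau>_def right_diff_distrib)
    \<comment> \<open>The definition of \<open>\<tau>\<close> cancels \<open>r\<close>; at the
      extreme exponent \<open>lambda_star d\<close> is scaled exactly to
      \<open>1 / (D + 1)\<close>.\<close>
    then have "?m \<le> lambda_star d * exp (D * ln (1 + 1 / D))" using l0 by simp
    also have "\<dots> = 1 / (D + 1)" using lambda_star_mult_exp[of d] assms(1) by (simp add: D_def)
    finally show "?m \<le> 1 / (D + 1)" .
  qed simp

  \<comment> \<open>Strong induction on size, because the neighbours of \<open>u\<close> are deleted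
    successively inside \<open>S - {u}\<close>.\<close>
  have ratio: "\<exists>w. independence_poly S E z = independence_poly (S - {u}) E z * exp (- w)
          \<and> Re w \<le> \<tau> \<and> - (1 / D) \<le> Im w \<and> Im w \<le> 0"
    if "S \<subseteq> V" "u \<in> S" "card (nbrs S u) \<le> d" for S u
    using that
  proof (induction "card S" arbitrary: S u rule: less_induct)
    case less
    let ?k = "real (card (nbrs S u))"
    have fin: "finite S" using less.prems finite_V finite_subset by blast
    have smaller: "card U < card S" "U \<subseteq> V" if "U \<subseteq> S - {u}" for U
      using that fin less.prems by (auto intro!: psubset_card_mono)
    obtain s where s: "independence_poly S E z = independence_poly (S - {u}) E z * (1 + z * exp s)"
      "Re s \<le> ?k * \<tau>" "- ?k * (1 / D) \<le> Im s" "Im s \<le> 0"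
      using independence_poly_vertex_ratio[of S u d z \<tau> "1 / D",
          OF less.hyps[OF smaller] less.prems(1,2) assms(8)]
      by blast
    obtain m \<phi> where m: "1 + z * exp s = 1 - of_real m * cis (- \<phi>)" "0 < m"
      "Re s \<le> D * \<tau> \<Longrightarrow> m \<le> 1 / (D + 1)" "\<phi> = \<theta> - Im s"
      using polar by blast
    have k: "?k \<le> D" using less.prems(3) by (simp add: D_def)
    have "?k * \<tau> \<le> D * \<tau>" using k \<tau>0 by (intro mult_right_mono)
    with s(2) m(3) have m_le: "m \<le> 1 / (D + 1)" by simp
    have "?k * (1 / D) \<le> 1" using k D by simp
    with s(3) have "- 1 \<le> Im s" by simp
    \<comment> \<open>Here \<open>\<phi> \<le> pi / 2 + 1\<close>, and
      \<open>pi \<ge> 2\<close>.\<close>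
    then have "\<phi> \<le> pi" "\<theta> \<le> \<phi>" using m(4) s(4) \<theta>_half pi_ge_two by auto
    then have "\<exists>w. 1 - of_real m * cis (- \<phi>) = exp (- w) \<and> Re w \<le> ln (1 + 1 / D) - r / D
            \<and> - (1 / D) \<le> Im w \<and> Im w \<le> 0"
      using D m(2) m_le assms(3,6) cos\<theta> by (intro rectangle_step[where \<theta> = \<theta>]) (auto simp: D_def)
    then show ?case unfolding s(1) m(1) \<tau>_def by auto
  qed

  have "independence_poly S E z \<noteq> 0" if "S \<subseteq> V" for S
  proof -
    have "finite S" using that finite_V finite_subset by blast
    then show ?thesis using that
    proof (induction S)
      case empty
      show ?case by (simp add: independence_poly_empty)
    next
      case (insert v S)
      let ?T = "insert v S"
      let ?k = "real (card (nbrs ?T v))"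
      have rem: "?T - {v} = S" using insert.hyps by auto
      have sub: "U \<subseteq> V" if "U \<subseteq> ?T - {v}" for U
        using that insert.prems by auto
      obtain s where s: "independence_poly ?T E z = independence_poly S E z * (1 + z * exp s)"
        "- ?k * (1 / D) \<le> Im s" "Im s \<le> 0"
        using independence_poly_vertex_ratio[of ?T v d z \<tau> "1 / D",
            OF ratio[OF sub] insert.prems insertI1 assms(8)]
        unfolding rem by blast
      obtain m \<phi> where m: "1 + z * exp s = 1 - of_real m * cis (- \<phi>)" "0 < m" "\<phi> = \<theta> - Im s"
        using polar by blast
      have "card (nbrs ?T v) \<le> d + 1"
        using card_nbrs_le_max_degree[OF insert.prems, of v] insert.prems assms(8) by simp
      then have "?k \<le> D + 1" by (simp add: D_def)
      then have "?k * (1 / D) \<le> 2" using D by (simp add: divide_le_eq)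
      with s(2) have "- 2 \<le> Im s" by simp
      then have \<phi>: "0 < \<phi>" "\<phi> < 2 * pi" using m(3) s(3) assms(3) \<theta>_half pi_ge_two by auto
      \<comment> \<open>No bound on \<open>m\<close> is available; the argument alone separates the
        point from 1.\<close>
      have "1 - of_real m * cis (- \<phi>) \<noteq> 0"
      proof
        assume "1 - of_real m * cis (- \<phi>) = 0"
        then have e: "of_real m * cis (- \<phi>) = 1" by simp
        have "norm (of_real m * cis (- \<phi>)) = m" using m(2) by (simp add: norm_mult)
        then have "m = 1" using e by simp
        with e have "cos \<phi> = 1" by (simp add: complex_eq_iff)
        then have "sin (\<phi> / 2) = 0" using cos_double_sin[of "\<phi> / 2"] by simp
        moreover have "0 < sin (\<phi> / 2)" using \<phi> by (intro sin_gt_zero) auto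
        ultimately show False by simp
      qed
      then show ?case using insert s(1) m(1) by simp
    qed
  qed
  then show ?thesis by simp
qed

end
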